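(* Let $(G,\mathsf X)$ be a contracting self-similar action whose limit space $\mathcal J_G$ has a self-similar structure $\mathcal L=(\mathcal J_G,\mathsf X,\{F_i\}_{i\in\mathsf X})$ (with associated surjection the quotient map $p:\mathsf X^{-\omega}\to\mathcal J_G$). Then $\mathcal L$ is a post-critically finite self-similar structure if and only if $(G,\mathsf X)$ is a post-critically finite action.
   Context: Let $\mathsf X$ be a finite set (the alphabet). $\mathsf X^*$ is the set of finite words $x_n\ldots x_2x_1$ over $\mathsf X$ (including the empty word $\varnothing$), a rooted tree with root $\varnothing$ in which $w$ is joined to $wx$ for $x\in\mathsf X$. $\mathsf X^{-\omega}$ is the set of left-infinite words $\ldots x_2x_1$ with the product topology ($\mathsf X$ discrete), and $\sigma:\mathsf X^{-\omega}\to\mathsf X^{-\omega}$ is the shift $\sigma(\ldots x_2x_1)=\ldots x_3x_2$. For $g\in\operatorname{Aut}\mathsf X^*$ (rooted tree automorphisms) and $v\in\mathsf X^*$ the restriction $g|_v$ is defined by $g(vw)=g(v)\,g|_v(w)$ for all $w\in\mathsf X^*$ (words are read from left to right). A self-similar action $(G,\mathsf X)$ is a faithful action of a group $G$ on $\mathsf X^*$ by automorphisms (so $G\le\operatorname{Aut}\mathsf X^*$) such that $g|_x\in G$ for all $g\in G$, $x\in\mathsf X$. It is contracting if there is a finite set $\mathcal N\subset G$ such that for every $g\in G$ there is $k\in\mathbb N$ with $g|_w\in\mathcal N$ whenever $|w|\ge k$; the smallest such $\mathcal N$ is the nucleus. The Moore diagram of $\mathcal N$ is the directed graph with vertex set $\mathcal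 N$ (vertices are called states) having, for every $g\in\mathcal N$ and $x\in\mathsf X$, an arrow from $g$ to $g|_x$ labeled $(x,g(x))$. A left-infinite path $\ldots e_2e_1$ is a sequence of arrows such that $e_{n+1}$ ends where $e_n$ starts; it ends at the end vertex of $e_1$. The contracting action is post-critically finite if there are only finitely many left-infinite paths in the Moore diagram of its nucleus which end at a non-trivial (non-identity) state. Two words $\ldots x_2x_1,\ \ldots y_2y_1\in\mathsf X^{-\omega}$ are asymptotically equivalent if there is a sequence $(g_k)_{k\ge1}$ in $G$, taking only finitely many values, with $g_k(x_k\ldots x_1)=y_k\ldots y_1$ for all $k$. The limit space $\mathcal J_G$ is the quotient topological space of $\mathsf X^{-\omega}$ by this relation, with quotient map $p$. A self-similar structure on a compact metrizable space $K$ is a system $\mathcal L=(K,\mathsf X,\{F_i\}_{i\in\mathsf X})$ of continuous injections $F_i:K\to K$ for which there is a continuous surjection $\pi:\mathsf X^{-\omega}\to K$ with $F_i\circ\pi=\pi\circ i$ for all $i\in\mathsf X$, where $i(\ldots x_2x_1)=\ldots x_2x_1i$; $\pi$ is unique and is called the associated surjection. A self-similar structure on a limit space $\mathcal J_G$ always means one with $\pi=p$. Put $K_i=F_i(K)$. The critical set is $\mathcal C=\pi^{-1}\bigl(\bigcup_{i\ne j}(K_i\cap K_j)\bigr)$ and the post-critical set is $\mathcal P=\bigcup_{n\ge1}\sigma^n(\mathcal C)$. $\mathcal L$ is post-critically finite if $\mathcal P$ is finite. *)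

theory Defs
  imports
    "HOL-Analysis.Analysis"
    "HOL-Algebra.Group"
    "Graph_Theory.Digraph"
begin

section \<open>Automorphisms of the tree of words\<close>

text \<open>The alphabet is a finite type. A finite word is a list read from left to right, so that
  the list \<open>[a, b]\<close> is the word \<open>ab\<close> and the children of \<open>w\<close> are the words \<open>w @ [x]\<close>.\<close>

definition tree_edge :: "'x list \<Rightarrow> 'x list \<Rightarrow> bool" where
  "tree_edge u v \<longleftrightarrow> (\<exists>x. v = u @ [x]) \<or> (\<exists>x. u = v @ [x])"

definition is_tree_aut :: "('x list \<Rightarrow> 'x list) \<Rightarrow> bool" where
  "is_tree_aut g \<longleftrightarrow> bij g \<and> g [] = [] \<and> (\<forall>u v. tree_edge (g u) (g v) \<longleftrightarrow> tree_edge u v)"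

definition tree_aut_group :: "('x list \<Rightarrow> 'x list) monoid" where
  "tree_aut_group = \<lparr>carrier = {g. is_tree_aut g}, mult = (\<circ>), one = id\<rparr>"

lemma group_tree_aut_group: "group (tree_aut_group :: ('x list \<Rightarrow> 'x list) monoid)"
proof (rule groupI)
  fix g :: "'x list \<Rightarrow> 'x list"
  assume "g \<in> carrier tree_aut_group"
  then have g: "bij g" "g [] = []" "\<And>u v. tree_edge (g u) (g v) \<longleftrightarrow> tree_edge u v"
    by (auto simp: tree_aut_group_def is_tree_aut_def)
  have "tree_edge (the_inv g u) (the_inv g v) \<longleftrightarrow> tree_edge u v" for u v
    using g(3)[of "the_inv g u" "the_inv g v"] g(1)
    by (simp add: bij_def f_the_inv_into_f)
  moreover have "bij (the_inv g)"
    using g(1) by (simp add: bij_betw_the_inv_into)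
  moreover have "the_inv g [] = []"
    using g(1,2) by (metis bij_def the_inv_f_f)
  moreover have "the_inv g \<circ> g = id"
    using g(1) by (auto simp: bij_def the_inv_f_f)
  ultimately show "\<exists>h\<in>carrier tree_aut_group. h \<otimes>\<^bsub>tree_aut_group\<^esub> g = \<one>\<^bsub>tree_aut_group\<^esub>"
    by (auto simp: tree_aut_group_def is_tree_aut_def)
qed (auto simp: tree_aut_group_def is_tree_aut_def bij_comp comp_assoc)

definition restriction :: "('x list \<Rightarrow> 'x list) \<Rightarrow> 'x list \<Rightarrow> 'x list \<Rightarrow> 'x list" where
  "restriction g v = (THE h. \<forall>w. g (v @ w) = g v @ h w)"

lemma is_tree_aut_snoc:
  assumes "is_tree_aut g"
  shows "\<exists>y. g (w @ [x]) = g w @ [y]"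
proof -
  have edge: "tree_edge (g u) (g v) \<longleftrightarrow> tree_edge u v" for u v
    using assms by (simp add: is_tree_aut_def)
  show ?thesis
  proof (induction w arbitrary: x rule: rev_induct)
    case Nil
    have root: "g [] = []"
      using assms by (simp add: is_tree_aut_def)
    have "tree_edge (g []) (g [x])"
      unfolding edge by (simp add: tree_edge_def)
    then show ?case
      unfolding root by (auto simp: tree_edge_def)
  next
    case (snoc z v)
    obtain y where y: "g (v @ [z]) = g v @ [y]"
      using snoc by blast
    have "tree_edge (g (v @ [z])) (g ((v @ [z]) @ [x]))"
      unfolding edge by (simp add: tree_edge_def)
    moreover have "g ((v @ [z]) @ [x]) \<noteq> g v"
      using assms unfolding is_tree_aut_def bij_def inj_def by force
    ultimately show ?case
      using y by (auto simp: tree_edge_def)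
  qed
qed

lemma restriction:
  assumes "is_tree_aut g"
  shows "g (v @ w) = g v @ restriction g v w"
proof -
  have "\<exists>u. g (v @ w) = g v @ u" for w
  proof (induction w rule: rev_induct)
    case (snoc x w)
    then show ?case
      using is_tree_aut_snoc[OF assms, of "v @ w" x] by auto
  qed auto
  then obtain h where h: "\<forall>w. g (v @ w) = g v @ h w"
    by metis
  have "restriction g v = h"
    unfolding restriction_def using h by (intro the_equality) auto
  then show ?thesis
    using h by simp
qed


section \<open>Contracting self-similar actions\<close>

definition self_similar_action :: "('x list \<Rightarrow> 'x list) set \<Rightarrow> bool" where
  "self_similar_action G \<longleftrightarrow>
     subgroup G tree_aut_group \<and> (\<forall>g\<in>G. \<forall>x. restriction g [x] \<in> G)"

definition contracting_core :: "('x list \<Rightarrow> 'x list) set \<Rightarrow> ('x list \<Rightarrow> 'x list) set \<Rightarrow> bool" where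
  "contracting_core G N \<longleftrightarrow>
     finite N \<and> N \<subseteq> G \<and> (\<forall>g\<in>G. \<exists>k. \<forall>w. k \<le> length w \<longrightarrow> restriction g w \<in> N)"

definition contracting_action :: "('x list \<Rightarrow> 'x list) set \<Rightarrow> bool" where
  "contracting_action G \<longleftrightarrow> self_similar_action G \<and> (\<exists>N. contracting_core G N)"

text \<open>The least set with respect to inclusion.\<close>

definition nucleus :: "('x list \<Rightarrow> 'x list) set \<Rightarrow> ('x list \<Rightarrow> 'x list) set" where
  "nucleus G = (LEAST N. contracting_core G N)"

lemma contracting_core_Int:
  assumes "contracting_core G M" "contracting_core G N"
  shows "contracting_core G (M \<inter> N)"
  unfolding contracting_core_def
proof (intro conjI ballI)
  fix g assume "g \<in> G"
  then obtain k l where "\<forall>w. k \<le> length w \<longrightarrow> restriction g w \<in> M"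
    "\<forall>w. l \<le> length w \<longrightarrow> restriction g w \<in> N"
    using assms unfolding contracting_core_def by meson
  then show "\<exists>k. \<forall>w. k \<le> length w \<longrightarrow> restriction g w \<in> M \<inter> N"
    by (intro exI[of _ "max k l"]) auto
qed (use assms in \<open>auto simp: contracting_core_def\<close>)

lemma nucleus_least:
  assumes "contracting_action G"
  shows "contracting_core G (nucleus G)"
    and "contracting_core G N \<Longrightarrow> nucleus G \<subseteq> N"
proof -
  obtain M where M: "contracting_core G M" "\<And>N. contracting_core G N \<Longrightarrow> card M \<le> card N"
    using assms ex_has_least_nat[of "contracting_core G" _ card]
    unfolding contracting_action_def by blast
  have least: "M \<subseteq> N" if "contracting_core G N" for N
  proof -
    have "finite M" using M(1) by (simp add: contracting_core_def)
    moreover have "card M \<le> card (M \<inter> N)"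
      using M(2) contracting_core_Int[OF M(1) that] .
    ultimately have "M \<inter> N = M"
      by (intro card_seteq) auto
    then show ?thesis by blast
  qed
  then have "nucleus G = M"
    unfolding nucleus_def using M(1) by (intro Least_equality) auto
  then show "contracting_core G (nucleus G)" "contracting_core G N \<Longrightarrow> nucleus G \<subseteq> N"
    using M(1) least by auto
qed

text \<open>An arrow is a triple of its source, its label and its target.\<close>

type_synonym 'x arrow = "('x list \<Rightarrow> 'x list) \<times> ('x \<times> 'x) \<times> ('x list \<Rightarrow> 'x list)"

definition moore_diagram ::
    "('x list \<Rightarrow> 'x list) set \<Rightarrow> ('x list \<Rightarrow> 'x list, 'x arrow) pre_digraph" where
  "moore_diagram N =
     \<lparr>verts = N,
      arcs = {(g, (x, y), h). g \<in> N \<and> g [x] = [y] \<and> h = restriction g [x]},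
      tail = (\<lambda>(g, l, h). g),
      head = (\<lambda>(g, l, h). h)\<rparr>"

text \<open>Left-infinite sequences \<open>\<dots> e\<^sub>2 e\<^sub>1\<close> are functions on the naturals with \<open>e n\<close> standing for
  \<open>e\<^sub>n\<^sub>+\<^sub>1\<close>; in particular such a path ends at the end vertex of \<open>e 0\<close>.\<close>

definition left_infinite_path :: "('a, 'b) pre_digraph \<Rightarrow> (nat \<Rightarrow> 'b) \<Rightarrow> bool" where
  "left_infinite_path D e \<longleftrightarrow>
     (\<forall>n. e n \<in> arcs D) \<and> (\<forall>n. head D (e (Suc n)) = tail D (e n))"

definition pcf_action :: "('x list \<Rightarrow> 'x list) set \<Rightarrow> bool" where
  "pcf_action G \<longleftrightarrow> contracting_action G \<and>
     finite {e. left_infinite_path (moore_diagram (nucleus G)) e \<and>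
                head (moore_diagram (nucleus G)) (e 0) \<noteq> id}"


section \<open>The limit space\<close>

text \<open>The left-infinite word \<open>\<dots> x\<^sub>2 x\<^sub>1\<close> is the function with \<open>x n\<close> standing for \<open>x\<^sub>n\<^sub>+\<^sub>1\<close>.\<close>

type_synonym 'x left_word = "nat \<Rightarrow> 'x"

definition left_word_topology :: "'x left_word topology" where
  "left_word_topology = product_topology (\<lambda>n. discrete_topology UNIV) UNIV"

definition shift :: "'x left_word \<Rightarrow> 'x left_word" where
  "shift x = (\<lambda>n. x (Suc n))"

definition append_letter :: "'x \<Rightarrow> 'x left_word \<Rightarrow> 'x left_word" where
  "append_letter i x = case_nat i x"

text \<open>The finite word \<open>x\<^sub>k \<dots> x\<^sub>1\<close>.\<close>

definition last_letters :: "nat \<Rightarrow> 'x left_word \<Rightarrow> 'x list" where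
  "last_letters k x = map x (rev [0..<k])"

definition asymptotic_rel :: "('x list \<Rightarrow> 'x list) set \<Rightarrow> ('x left_word \<times> 'x left_word) set" where
  "asymptotic_rel G =
     {(x, y). \<exists>g. (\<forall>k\<ge>1. g k \<in> G) \<and> finite (g ` {1..}) \<and>
                  (\<forall>k\<ge>1. g k (last_letters k x) = last_letters k y)}"

definition limit_map :: "('x list \<Rightarrow> 'x list) set \<Rightarrow> 'x left_word \<Rightarrow> 'x left_word set" where
  "limit_map G x = asymptotic_rel G `` {x}"

definition limit_space :: "('x list \<Rightarrow> 'x list) set \<Rightarrow> 'x left_word set topology" where
  "limit_space G =
     topology (\<lambda>U. U \<subseteq> UNIV // asymptotic_rel G \<and> openin left_word_topology (limit_map G -` U))"

lemma openin_limit_space: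
  "openin (limit_space G) U \<longleftrightarrow>
     U \<subseteq> UNIV // asymptotic_rel G \<and> openin left_word_topology (limit_map G -` U)"
proof -
  have "istopology (\<lambda>U. U \<subseteq> UNIV // asymptotic_rel G \<and>
                        openin left_word_topology (limit_map G -` U))"
    unfolding istopology_def by (auto simp: vimage_Union intro: openin_clauses)
  then show ?thesis
    by (simp add: limit_space_def topology_inverse')
qed

lemma topspace_limit_space: "topspace (limit_space G) = UNIV // asymptotic_rel G"
proof
  show "topspace (limit_space G) \<subseteq> UNIV // asymptotic_rel G"
    using openin_limit_space openin_topspace by blast
  have "limit_map G -` (UNIV // asymptotic_rel G) = topspace left_word_topology"
    by (auto simp: limit_map_def left_word_topology_def quotientI)
  then have "openin (limit_space G) (UNIV // asymptotic_rel G)"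
    by (simp add: openin_limit_space)
  then show "UNIV // asymptotic_rel G \<subseteq> topspace (limit_space G)"
    by (rule openin_subset)
qed

lemma quotient_map_limit_map: "quotient_map left_word_topology (limit_space G) (limit_map G)"
  unfolding quotient_map_def topspace_limit_space openin_limit_space
  by (auto simp: limit_map_def left_word_topology_def quotient_def vimage_def)

lemma equiv_asymptotic_rel:
  assumes "self_similar_action G"
  shows "equiv UNIV (asymptotic_rel G)"
proof -
  have G: "subgroup G tree_aut_group"
    using assms by (simp add: self_similar_action_def)
  have aut: "is_tree_aut g" if "g \<in> G" for g
    using subgroup.mem_carrier[OF G that] by (simp add: tree_aut_group_def)
  have one: "id \<in> G"
    using subgroup.one_closed[OF G] by (simp add: tree_aut_group_def)
  have mult: "g \<circ> h \<in> G" if "g \<in> G" "h \<in> G" for g h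
    using subgroup.m_closed[OF G that] by (simp add: tree_aut_group_def)
  have inv_G: "inv_into UNIV g \<in> G" if "g \<in> G" for g
  proof -
    let ?h = "inv\<^bsub>tree_aut_group\<^esub> g"
    have "?h \<circ> g = id"
      using group.l_inv[OF group_tree_aut_group subgroup.mem_carrier[OF G that]]
      by (simp add: tree_aut_group_def)
    moreover have "bij g"
      using aut[OF that] by (simp add: is_tree_aut_def)
    ultimately have "inv_into UNIV g = ?h"
      by (metis comp_assoc comp_id id_comp bij_is_surj surj_iff)
    then show ?thesis
      using subgroup.m_inv_closed[OF G that] by simp
  qed
  show ?thesis
  proof (rule equivI)
    show "refl (asymptotic_rel G)"
    proof (rule refl_onI)
      fix x
      have "finite ((\<lambda>k. id) ` {1::nat..})"
        by (rule finite_subset[of _ "{id}"]) auto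
      then show "(x, x) \<in> asymptotic_rel G"
        using one unfolding asymptotic_rel_def by (auto intro!: exI[of _ "\<lambda>k. id"])
    qed
    show "sym (asymptotic_rel G)"
    proof (rule symI)
      fix x y assume "(x, y) \<in> asymptotic_rel G"
      then obtain g where g: "\<forall>k\<ge>1. g k \<in> G" "finite (g ` {1..})"
        "\<forall>k\<ge>1. g k (last_letters k x) = last_letters k y"
        by (auto simp: asymptotic_rel_def)
      have "finite ((\<lambda>k. inv_into UNIV (g k)) ` {1..})"
        using finite_imageI[OF g(2), of "inv_into UNIV"] by (simp add: image_image)
      moreover have "inv_into UNIV (g k) (last_letters k y) = last_letters k x" if "1 \<le> k" for k
        using g that aut by (metis bij_is_inj inv_f_f is_tree_aut_def)
      ultimately show "(y, x) \<in> asymptotic_rel G"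
        using g(1) inv_G by (auto simp: asymptotic_rel_def intro!: exI[of _ "\<lambda>k. inv_into UNIV (g k)"])
    qed
    show "trans (asymptotic_rel G)"
    proof (rule transI)
      fix x y z assume "(x, y) \<in> asymptotic_rel G" "(y, z) \<in> asymptotic_rel G"
      then obtain g h where g: "\<forall>k\<ge>1. g k \<in> G" "finite (g ` {1..})"
        "\<forall>k\<ge>1. g k (last_letters k x) = last_letters k y"
        and h: "\<forall>k\<ge>1. h k \<in> G" "finite (h ` {1..})"
        "\<forall>k\<ge>1. h k (last_letters k y) = last_letters k z"
        by (auto simp: asymptotic_rel_def)
      have "(\<lambda>k. h k \<circ> g k) ` {1..} \<subseteq> (\<lambda>(a, b). a \<circ> b) ` (h ` {1..} \<times> g ` {1..})"
        by auto
      then have "finite ((\<lambda>k. h k \<circ> g k) ` {1..})"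
        using g(2) h(2) by (meson finite_SigmaI finite_imageI finite_subset)
      then show "(x, z) \<in> asymptotic_rel G"
        using g h mult
        by (auto simp: asymptotic_rel_def intro!: exI[of _ "\<lambda>k. h k \<circ> g k"])
    qed
  qed simp
qed


section \<open>Self-similar structures\<close>

text \<open>The associated surjection \<open>\<pi>\<close> is determined by \<open>K\<close> and \<open>F\<close>; it is carried
  along as a parameter.\<close>

definition self_similar_structure ::
    "'k topology \<Rightarrow> ('x \<Rightarrow> 'k \<Rightarrow> 'k) \<Rightarrow> ('x left_word \<Rightarrow> 'k) \<Rightarrow> bool" where
  "self_similar_structure K F \<pi> \<longleftrightarrow>
     compact_space K \<and> metrizable_space K \<and>
     (\<forall>i. continuous_map K K (F i) \<and> inj_on (F i) (topspace K)) \<and>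
     continuous_map left_word_topology K \<pi> \<and> \<pi> ` topspace left_word_topology = topspace K \<and>
     (\<forall>i. F i \<circ> \<pi> = \<pi> \<circ> append_letter i)"

definition critical_set ::
    "'k topology \<Rightarrow> ('x \<Rightarrow> 'k \<Rightarrow> 'k) \<Rightarrow> ('x left_word \<Rightarrow> 'k) \<Rightarrow> 'x left_word set" where
  "critical_set K F \<pi> = \<pi> -` (\<Union>i. \<Union>j\<in>- {i}. F i ` topspace K \<inter> F j ` topspace K)"

definition post_critical_set ::
    "'k topology \<Rightarrow> ('x \<Rightarrow> 'k \<Rightarrow> 'k) \<Rightarrow> ('x left_word \<Rightarrow> 'k) \<Rightarrow> 'x left_word set" where
  "post_critical_set K F \<pi> = (\<Union>n\<in>{1..}. (shift ^^ n) ` critical_set K F \<pi>)"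

definition pcf_structure ::
    "'k topology \<Rightarrow> ('x \<Rightarrow> 'k \<Rightarrow> 'k) \<Rightarrow> ('x left_word \<Rightarrow> 'k) \<Rightarrow> bool" where
  "pcf_structure K F \<pi> \<longleftrightarrow>
     self_similar_structure K F \<pi> \<and> finite (post_critical_set K F \<pi>)"

end

theory Submission
  imports Defs
begin

text \<open>Both finiteness conditions concern left-infinite paths in the Moore diagram of the nucleus that
  end at a non-trivial state: the post-critical words are exactly the labels of these paths, and
  finitely many labels leave room for only finitely many paths.

  The first ingredient is that two left-infinite words are asymptotically equivalent exactly when
  they are the two labels of such a path (with an arbitrary end): contraction pushes the finitely
  many group elements that witness an equivalence into the nucleus, and a compactness argument
  assembles the resulting finite paths into an infinite one (\<open>asymptotic_imp_state_path\<close>).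

  The second ingredient identifies the post-critical set. A word is critical when it is equivalent to a
  word with a different last letter, so the corresponding path passes through a state that moves a
  letter. All earlier states on the path are non-trivial, since restrictions of the identity are
  trivial; hence every post-critical word is a label of a path ending at a non-trivial state
  (\<open>post_critical_imp_state_path\<close>). Conversely, a non-trivial end state moves some word, and
  prolonging the path along that word up to the first letter that is moved produces critical words
  whose shifts are the labels of the given path (\<open>state_path_imp_post_critical\<close>).

  Finally, a pair of labels belongs to only finitely many paths, because a state determines all
  later states of a path with given labels, and the nucleus is finite (\<open>finite_coherent_sequences\<close>).\<close>


section \<open>Restrictions of tree automorphisms\<close>

lemma restriction_eqI:
  assumes "\<And>w. g (v @ w) = g v @ h w"
  shows "restriction g v = h"
  unfolding restriction_def by (rule the_equality) (use assms in auto)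

lemma restriction_id [simp]: "restriction id v = id"
  by (rule restriction_eqI) simp

lemma restriction_append:
  assumes "is_tree_aut g"
  shows "restriction g (v @ w) = restriction (restriction g v) w"
proof -
  have "g ((v @ w) @ u) = g v @ restriction g v (w @ u)" for u
    using restriction[OF assms, of v "w @ u"] by simp
  moreover have "g ((v @ w) @ u) = g v @ restriction g v w @ restriction g (v @ w) u" for u
    using restriction[OF assms, of "v @ w" u] restriction[OF assms, of v w] by simp
  ultimately have "restriction g v (w @ u) = restriction g v w @ restriction g (v @ w) u" for u
    by (metis same_append_eq)
  then show ?thesis
    by (intro restriction_eqI[symmetric])
qed

lemma is_tree_aut_length:
  assumes "is_tree_aut g"
  shows "length (g v) = length v"
proof (induction v rule: rev_induct)
  case Nil
  then show ?case
    using assms by (simp add: is_tree_aut_def)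
next
  case (snoc x v)
  then show ?case
    using is_tree_aut_snoc[OF assms, of v x] by auto
qed

lemma is_tree_aut_letter:
  assumes "is_tree_aut g"
  obtains y where "g [x] = [y]"
  using is_tree_aut_snoc[OF assms, of "[]" x] assms by (auto simp: is_tree_aut_def)

lemma is_tree_aut_Cons:
  assumes "is_tree_aut g"
  shows "g (x # w) = g [x] @ restriction g [x] w"
  using restriction[OF assms, of "[x]" w] by simp


section \<open>Left-infinite words\<close>

lemma last_letters_Suc: "last_letters (Suc k) x = x k # last_letters k x"
  by (simp add: last_letters_def)

lemma last_letters_split:
  assumes "k \<le> n"
  shows "last_letters n x = map x (rev [k..<n]) @ last_letters k x"
proof -
  have "[0..<n] = [0..<k] @ [k..<n]"
    using assms upt_add_eq_append[of 0 k "n - k"] by simp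
  then show ?thesis
    by (simp add: last_letters_def)
qed

lemma map_rev_upt_Suc:
  assumes "k < n"
  shows "map x (rev [k..<n]) = map x (rev [Suc k..<n]) @ [x k]"
  using assms by (simp add: upt_conv_Cons)

lemma append_letter_simps [simp]:
  "append_letter i x 0 = i" "append_letter i x (Suc n) = x n"
  by (simp_all add: append_letter_def)

lemma shift_append_letter [simp]: "shift (append_letter i x) = x"
  by (simp add: shift_def)

lemma append_letter_shift: "append_letter (x 0) (shift x) = x"
  by (auto simp: append_letter_def shift_def split: nat.split)

lemma funpow_shift: "(shift ^^ n) x = (\<lambda>k. x (k + n))"
  by (induction n) (auto simp: shift_def)


section \<open>Paths in the Moore diagram\<close>

text \<open>Since an arrow is determined by its source, its label and its target, a left-infinite path is
  the same thing as the sequence of its states together with the two words read off its labels. The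
  state \<open>s 0\<close> is the end of the path, and the arrow with label \<open>(x n, y n)\<close> leads from
  \<open>s (Suc n)\<close> to \<open>s n\<close>.\<close>

definition state_path ::
    "('x list \<Rightarrow> 'x list) set \<Rightarrow> 'x left_word \<Rightarrow> 'x left_word \<Rightarrow> (nat \<Rightarrow> 'x list \<Rightarrow> 'x list) \<Rightarrow> bool" where
  "state_path N x y s \<longleftrightarrow>
     (\<forall>n. s n \<in> N \<and> s (Suc n) [x n] = [y n] \<and> s n = restriction (s (Suc n)) [x n])"

lemma state_pathI:
  assumes "\<And>n. s n \<in> N" and "\<And>n. s (Suc n) [x n] = [y n]"
    and "\<And>n. s n = restriction (s (Suc n)) [x n]"
  shows "state_path N x y s"
  unfolding state_path_def using assms by blast

lemma state_pathD:
  assumes "state_path N x y s"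
  shows "s n \<in> N" and "s (Suc n) [x n] = [y n]" and "restriction (s (Suc n)) [x n] = s n"
  using assms unfolding state_path_def by metis+

definition arrow_path ::
    "'x left_word \<Rightarrow> 'x left_word \<Rightarrow> (nat \<Rightarrow> 'x list \<Rightarrow> 'x list) \<Rightarrow> nat \<Rightarrow> 'x arrow" where
  "arrow_path x y s = (\<lambda>n. (s (Suc n), (x n, y n), s n))"

text \<open>An arrow of \<open>moore_diagram N\<close> starts in \<open>N\<close>; that its target lies in \<open>N\<close> too is what the
  closure hypothesis provides, and it matters only for the end of the path.\<close>

lemma left_infinite_path_iff_state_path:
  assumes closed: "\<And>g x. g \<in> N \<Longrightarrow> restriction g [x] \<in> N"
  shows "left_infinite_path (moore_diagram N) e \<longleftrightarrow>
    (\<exists>x y s. state_path N x y s \<and> e = arrow_path x y s)"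
proof
  assume e: "left_infinite_path (moore_diagram N) e"
  define x y s where "x = (\<lambda>n. fst (fst (snd (e n))))"
    and "y = (\<lambda>n. snd (fst (snd (e n))))" and "s = (\<lambda>n. snd (snd (e n)))"
  have tail: "s (Suc n) = fst (e n)" for n
    using e unfolding left_infinite_path_def moore_diagram_def s_def
    by (auto simp: case_prod_unfold)
  then have "e = arrow_path x y s"
    by (auto simp: arrow_path_def x_def y_def s_def)
  moreover have arc: "s (Suc n) \<in> N \<and> s (Suc n) [x n] = [y n] \<and> s n = restriction (s (Suc n)) [x n]" for n
  proof -
    have "e n \<in> arcs (moore_diagram N)"
      using e by (simp add: left_infinite_path_def)
    then show ?thesis
      unfolding tail by (auto simp: moore_diagram_def x_def y_def s_def)
  qed
  moreover have "s n \<in> N" for n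
    using arc closed by metis
  ultimately show "\<exists>x y s. state_path N x y s \<and> e = arrow_path x y s"
    unfolding state_path_def by blast
next
  assume "\<exists>x y s. state_path N x y s \<and> e = arrow_path x y s"
  then obtain x y s where s: "state_path N x y s" and e: "e = arrow_path x y s"
    by blast
  show "left_infinite_path (moore_diagram N) e"
    unfolding e by (simp add: state_pathD[OF s] arrow_path_def left_infinite_path_def moore_diagram_def)
qed

text \<open>Two coherent sequences that differ somewhere differ from there on. Finitely many distinct
  sequences are therefore already told apart by a single sufficiently late value, so there are at
  most \<open>card N\<close> of them.\<close>

lemma finite_coherent_sequences:
  assumes N: "finite N"
  shows "finite {s. \<forall>n::nat. s n \<in> N \<and> s n = f n (s (Suc n))}" (is "finite ?S")
proof (rule ccontr)
  define S where "S = ?S"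
  have S: "s n \<in> N" "s n = f n (s (Suc n))" if "s \<in> S" for s n
    using that unfolding S_def by blast+
  assume "infinite ?S"
  then have "infinite S"
    unfolding S_def .
  then obtain T where T: "T \<subseteq> S" "finite T" "card T = Suc (card N)"
    using infinite_arbitrarily_large[of S "Suc (card N)"] by blast
  have differ_later: "s m \<noteq> t m" if "s \<in> T" "t \<in> T" "s n \<noteq> t n" "n \<le> m" for s t n m
    using that(4)
  proof (induction m rule: dec_induct)
    case base
    show ?case by (rule that(3))
  next
    case (step m)
    have "s m = f m (s (Suc m))" "t m = f m (t (Suc m))"
      using that(1,2) T(1) S(2) by blast+
    then show ?case
      using step(3) by metis
  qed
  define d where "d s t = (SOME n. s n \<noteq> t n)" for s t :: "nat \<Rightarrow> 'a"
  have d: "s (d s t) \<noteq> t (d s t)" if "s \<noteq> t" for s t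
  proof -
    have "\<exists>n. s n \<noteq> t n"
      using that by blast
    then show ?thesis
      unfolding d_def by (rule someI_ex)
  qed
  define M where "M = Max ((\<lambda>(s, t). d s t) ` (T \<times> T))"
  have "d s t \<le> M" if "s \<in> T" "t \<in> T" for s t
    unfolding M_def by (rule Max_ge) (use T(2) that in auto)
  then have "inj_on (\<lambda>s. s M) T"
    using d differ_later by (intro inj_onI) blast
  moreover have "(\<lambda>s. s M) ` T \<subseteq> N"
    using T(1) S(1) by blast
  ultimately have "card T \<le> card N"
    using N card_inj_on_le by blast
  then show False
    using T(3) by simp
qed


section \<open>Critical words\<close>

text \<open>Because \<open>\<pi>\<close> intertwines \<open>F i\<close> with appending the letter \<open>i\<close>, the piece \<open>F i ` K\<close> consists of
  the images of the words with last letter \<open>i\<close>.\<close>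

lemma critical_set_iff:
  assumes "self_similar_structure K F \<pi>"
  shows "x \<in> critical_set K F \<pi> \<longleftrightarrow> (\<exists>y. y 0 \<noteq> x 0 \<and> \<pi> x = \<pi> y)"
proof -
  have onto: "topspace K = range \<pi>"
    using assms by (simp add: self_similar_structure_def left_word_topology_def)
  have append: "F i (\<pi> z) = \<pi> (append_letter i z)" for i z
    using assms unfolding self_similar_structure_def by (metis comp_apply)
  have piece: "k \<in> F i ` topspace K \<longleftrightarrow> (\<exists>z. z 0 = i \<and> k = \<pi> z)" for i k
  proof
    assume "k \<in> F i ` topspace K"
    then obtain z where "k = \<pi> (append_letter i z)"
      unfolding onto using append by auto
    then show "\<exists>z. z 0 = i \<and> k = \<pi> z"
      by (metis append_letter_simps(1))
  next
    assume "\<exists>z. z 0 = i \<and> k = \<pi> z"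
    then obtain z where "z 0 = i" "k = \<pi> z"
      by blast
    then have "k = F i (\<pi> (shift z))"
      by (metis append append_letter_shift)
    then show "k \<in> F i ` topspace K"
      unfolding onto by blast
  qed
  have "x \<in> critical_set K F \<pi> \<longleftrightarrow>
    (\<exists>i j. i \<noteq> j \<and> \<pi> x \<in> F i ` topspace K \<and> \<pi> x \<in> F j ` topspace K)"
    by (auto simp: critical_set_def)
  then show ?thesis
    unfolding piece by metis
qed

lemma post_critical_set_iff:
  "x \<in> post_critical_set K F \<pi> \<longleftrightarrow>
    (\<exists>n z. z \<in> critical_set K F \<pi> \<and> x = (\<lambda>k. z (k + Suc n)))"
proof -
  have "{1..} = range Suc"
    by (auto simp: image_iff dest: Suc_le_D)
  then show ?thesis
    unfolding post_critical_set_def funpow_shift by auto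
qed

lemma shift_critical_post_critical:
  assumes "z \<in> critical_set K F \<pi>"
  shows "shift z \<in> post_critical_set K F \<pi>"
  unfolding post_critical_set_iff shift_def
  by (rule exI[of _ 0], rule exI[of _ z]) (use assms in simp)

lemma shift_post_critical:
  assumes "z \<in> post_critical_set K F \<pi>"
  shows "shift z \<in> post_critical_set K F \<pi>"
proof -
  obtain n u where u: "u \<in> critical_set K F \<pi>" "z = (\<lambda>k. u (k + Suc n))"
    using assms unfolding post_critical_set_iff by blast
  then have "shift z = (\<lambda>k. u (k + Suc (Suc n)))"
    by (simp add: shift_def)
  then show ?thesis
    unfolding post_critical_set_iff using u(1) by blast
qed


section \<open>Asymptotic equivalence and the nucleus\<close>

locale contracting =
  fixes G :: "('x list \<Rightarrow> 'x list) set"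
  assumes contracting: "contracting_action G"
begin

abbreviation N where "N \<equiv> nucleus G"

lemma aut:
  assumes "g \<in> G"
  shows "is_tree_aut g"
proof -
  have "subgroup G tree_aut_group"
    using contracting by (simp add: contracting_action_def self_similar_action_def)
  from subgroup.mem_carrier[OF this assms] show ?thesis
    by (simp add: tree_aut_group_def)
qed

lemma core: "contracting_core G N"
  using contracting by (rule nucleus_least(1))

lemma finite_nucleus: "finite N" and nucleus_subset: "N \<subseteq> G"
  using core by (simp_all add: contracting_core_def)

lemmas nucleus_aut = aut[OF subsetD[OF nucleus_subset]]

lemma eventually_nucleus:
  assumes "g \<in> G"
  obtains k where "\<And>w. k \<le> length w \<Longrightarrow> restriction g w \<in> N"
proof -
  have "\<exists>k. \<forall>w. k \<le> length w \<longrightarrow> restriction g w \<in> N"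
    using core assms unfolding contracting_core_def by blast
  then show ?thesis
    using that by blast
qed

text \<open>If \<open>g|\<^sub>x\<close> were outside the nucleus, then \<open>g\<close> could not occur among the restrictions to long
  words, so removing \<open>g\<close> would leave a smaller core.\<close>

lemma nucleus_restriction:
  assumes "g \<in> N"
  shows "restriction g [x] \<in> N"
proof (rule ccontr)
  assume out: "restriction g [x] \<notin> N"
  have "contracting_core G (N - {g})"
    unfolding contracting_core_def
  proof (intro conjI ballI)
    fix h assume h: "h \<in> G"
    obtain k where k: "\<And>w. k \<le> length w \<Longrightarrow> restriction h w \<in> N"
      using eventually_nucleus[OF h] by blast
    have "restriction h w \<noteq> g" if "k \<le> length w" for w
      using k[of "w @ [x]"] that out restriction_append[OF aut[OF h], of w "[x]"] by auto
    then show "\<exists>k. \<forall>w. k \<le> length w \<longrightarrow> restriction h w \<in> N - {g}"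
      using k by blast
  qed (use finite_nucleus nucleus_subset in auto)
  then show False
    using nucleus_least(2)[OF contracting] assms by blast
qed

lemma limit_map_eq_iff: "limit_map G x = limit_map G y \<longleftrightarrow> (x, y) \<in> asymptotic_rel G"
proof -
  have "equiv UNIV (asymptotic_rel G)"
    using contracting by (intro equiv_asymptotic_rel) (simp add: contracting_action_def)
  then show ?thesis
    unfolding limit_map_def by (simp add: eq_equiv_class_iff)
qed

text \<open>The state from which \<open>k\<close> arrows remain acts on the last \<open>k\<close> letters as the labels prescribe.\<close>

lemma state_path_imp_asymptotic:
  assumes "state_path N x y s"
  shows "(x, y) \<in> asymptotic_rel G"
proof -
  note s = state_pathD[OF assms]
  have "s k (last_letters k x) = last_letters k y" for k
  proof (induction k)
    case 0
    then show ?case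
      using nucleus_aut[OF s(1)] by (simp add: last_letters_def is_tree_aut_def)
  next
    case (Suc k)
    have "s (Suc k) (x k # last_letters k x) = [y k] @ s k (last_letters k x)"
      using is_tree_aut_Cons[OF nucleus_aut[OF s(1)], of "Suc k" "x k"] s(2)[of k] s(3)[of k] by simp
    then show ?case
      using Suc by (simp add: last_letters_Suc)
  qed
  moreover have "finite (s ` {1..})"
    using s(1) finite_nucleus by (meson finite_subset image_subsetI)
  moreover have "s k \<in> G" for k
    using s(1) nucleus_subset by blast
  ultimately show ?thesis
    unfolding asymptotic_rel_def by blast
qed

text \<open>If \<open>g\<^sub>n\<close> witnesses the equivalence on the last \<open>n\<close> letters, its restrictions along \<open>x\<close> form a
  finite path with the required labels, and all but the first few of its states are in the nucleus; the number
  of exceptions is bounded because the \<open>g\<^sub>n\<close> take finitely many values. The states of the infinite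
  path are chosen one after the other so that each finite piece occurs for infinitely many \<open>n\<close>.\<close>

lemma asymptotic_imp_state_path:
  assumes "(x, y) \<in> asymptotic_rel G"
  obtains s where "state_path N x y s"
proof -
  obtain g where g: "\<And>k. 1 \<le> k \<Longrightarrow> g k \<in> G" "finite (g ` {1..})"
      "\<And>k. 1 \<le> k \<Longrightarrow> g k (last_letters k x) = last_letters k y"
    using assms by (auto simp: asymptotic_rel_def)
  have "\<forall>h\<in>g ` {1..}. \<exists>k. \<forall>w. k \<le> length w \<longrightarrow> restriction h w \<in> N"
    using eventually_nucleus g(1) by (metis atLeast_iff imageE)
  then obtain l where l: "\<And>h w. h \<in> g ` {1..} \<Longrightarrow> l h \<le> length w \<Longrightarrow> restriction h w \<in> N"
    by metis
  define m where "m = Max (l ` g ` {1..})"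
  have m: "restriction (g n) w \<in> N" if "1 \<le> n" "m \<le> length w" for n w
  proof (rule l)
    show "g n \<in> g ` {1..}"
      using that by simp
    then have "l (g n) \<le> m"
      unfolding m_def using g(2) by (intro Max_ge) auto
    then show "l (g n) \<le> length w"
      using that by simp
  qed
  define h where "h n k = restriction (g n) (map x (rev [k..<n]))" for n k
  have h_in: "h n k \<in> N" if "Suc (k + m) \<le> n" for n k
    unfolding h_def by (rule m) (use that in auto)
  have h_Suc: "h n k = restriction (h n (Suc k)) [x k]" if "k < n" for n k
  proof -
    have "is_tree_aut (g n)"
      using that by (intro aut g(1)) auto
    then show ?thesis
      unfolding h_def map_rev_upt_Suc[OF that] by (rule restriction_append)
  qed
  have h_act: "h n (Suc k) [x k] = [y k]" if "Suc (Suc k + m) \<le> n" for n k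
  proof -
    have n: "1 \<le> n" "Suc k \<le> n"
      using that by auto
    note g_aut = aut[OF g(1)[OF n(1)]]
    have "g n (last_letters n x) = g n (map x (rev [Suc k..<n])) @ h n (Suc k) (last_letters (Suc k) x)"
      unfolding last_letters_split[OF n(2)] h_def by (rule restriction[OF g_aut])
    then have "g n (map x (rev [Suc k..<n])) @ h n (Suc k) (last_letters (Suc k) x)
      = map y (rev [Suc k..<n]) @ last_letters (Suc k) y"
      using g(3)[OF n(1)] last_letters_split[OF n(2), of y] by simp
    then have eq: "h n (Suc k) (x k # last_letters k x) = y k # last_letters k y"
      using is_tree_aut_length[OF g_aut, of "map x (rev [Suc k..<n])"]
      by (simp add: last_letters_Suc)
    have h_aut: "is_tree_aut (h n (Suc k))"
      by (rule nucleus_aut[OF h_in[OF that]])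
    obtain z where z: "h n (Suc k) [x k] = [z]"
      using is_tree_aut_letter[OF h_aut] .
    then show ?thesis
      using eq is_tree_aut_Cons[OF h_aut, of "x k" "last_letters k x"] by simp
  qed
  have pigeon: "\<exists>t\<in>N. infinite {n \<in> A. h n k = t}" if A: "infinite A" for A k
  proof -
    let ?B = "A \<inter> {Suc (k + m)..}"
    have "A \<subseteq> ?B \<union> {..<Suc (k + m)}"
      by auto
    then have B: "infinite ?B"
      using A by (meson finite_Un finite_lessThan finite_subset)
    have sub: "(\<lambda>n. h n k) ` ?B \<subseteq> N"
      using h_in by auto
    then obtain a where a: "a \<in> ?B" "infinite {n \<in> ?B. h n k = h a k}"
      using pigeonhole_infinite[OF B, of "\<lambda>n. h n k"] finite_nucleus finite_subset by blast
    have "{n \<in> ?B. h n k = h a k} \<subseteq> {n \<in> A. h n k = h a k}"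
      by auto
    then have "infinite {n \<in> A. h n k = h a k}"
      using a(2) finite_subset by blast
    then show ?thesis
      using a(1) sub by blast
  qed
  obtain s where s: "\<And>k. s k \<in> N \<and> infinite {n. h n k = s k}"
      "\<And>k. s (Suc k) [x k] = [y k] \<and> s k = restriction (s (Suc k)) [x k]"
  proof (rule dependent_nat_choice[where P = "\<lambda>k t. t \<in> N \<and> infinite {n. h n k = t}"
        and Q = "\<lambda>k t t'. t' [x k] = [y k] \<and> t = restriction t' [x k]", THEN exE])
    show "\<exists>t. t \<in> N \<and> infinite {n. h n 0 = t}"
      using pigeon[OF infinite_UNIV_nat, of 0] by auto
  next
    fix t k
    assume t: "t \<in> N \<and> infinite {n. h n k = t}"
    then obtain t' where t': "t' \<in> N" "infinite {n \<in> {n. h n k = t}. h n (Suc k) = t'}"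
      using pigeon by blast
    then obtain n where n: "Suc (Suc k + m) \<le> n" "h n k = t" "h n (Suc k) = t'"
      unfolding infinite_nat_iff_unbounded_le by blast
    have "infinite {n. h n (Suc k) = t'}"
      using t'(2) by (rule contrapos_nn) (rule finite_subset, auto)
    then show "\<exists>t'. (t' \<in> N \<and> infinite {n. h n (Suc k) = t'}) \<and>
        t' [x k] = [y k] \<and> t = restriction t' [x k]"
      using t'(1) n h_act[OF n(1)] h_Suc[of k n] by auto
  qed (use that in blast)
  then have "state_path N x y s"
    by (intro state_pathI) blast+
  then show ?thesis
    by (rule that)
qed


section \<open>Post-critical words as labels of paths\<close>

lemma state_path_extend:
  assumes path: "state_path N x y s" and "s 0 [a] = [b]"
  shows "state_path N (append_letter a x) (append_letter b y) (case_nat (restriction (s 0) [a]) s)"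
proof (rule state_pathI)
  note s = state_pathD[OF path]
  fix n
  show "case_nat (restriction (s 0) [a]) s n \<in> N"
    using s(1) nucleus_restriction by (cases n) auto
  show "case_nat (restriction (s 0) [a]) s (Suc n) [append_letter a x n] = [append_letter b y n]"
    using assms(2) s(2) by (cases n) auto
  show "case_nat (restriction (s 0) [a]) s n =
      restriction (case_nat (restriction (s 0) [a]) s (Suc n)) [append_letter a x n]"
    using s(3) by (cases n) auto
qed

lemma state_path_nontrivial_earlier:
  assumes "state_path N x y s" and "s n \<noteq> id"
  shows "s (n + m) \<noteq> id"
proof (induction m)
  case 0
  show ?case using assms(2) unfolding add_0_right .
next
  case (Suc m)
  have "restriction (s (Suc (n + m))) [x (n + m)] = s (n + m)"
    by (rule state_pathD(3)[OF assms(1)])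
  then show ?case
    using Suc by (metis add_Suc_right restriction_id)
qed

context
  fixes F :: "'x \<Rightarrow> 'x left_word set \<Rightarrow> 'x left_word set"
  assumes self_similar: "self_similar_structure (limit_space G) F (limit_map G)"
begin

abbreviation critical where "critical \<equiv> critical_set (limit_space G) F (limit_map G)"
abbreviation post_critical where "post_critical \<equiv> post_critical_set (limit_space G) F (limit_map G)"

text \<open>Induction on the moved word: either its first letter is moved and prolonging the path by that
  letter gives two equivalent words with different last letters, or the prolonged path ends at a
  state that moves the rest of the word.\<close>

lemma state_path_imp_post_critical:
  assumes "state_path N x y s" and "s 0 v \<noteq> v"
  shows "x \<in> post_critical \<and> y \<in> post_critical"
  using assms
proof (induction v arbitrary: x y s)
  case Nil
  have "is_tree_aut (s 0)"
    by (rule nucleus_aut[OF state_pathD(1)[OF Nil(1)]])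
  then show ?case
    using Nil(2) by (simp add: is_tree_aut_def)
next
  case (Cons a v)
  have s0: "is_tree_aut (s 0)"
    by (rule nucleus_aut[OF state_pathD(1)[OF Cons.prems(1)]])
  obtain b where b: "s 0 [a] = [b]"
    using is_tree_aut_letter[OF s0] .
  note path = state_path_extend[OF Cons.prems(1) b]
  show ?case
  proof (cases "a = b")
    case False
    have "limit_map G (append_letter a x) = limit_map G (append_letter b y)"
      unfolding limit_map_eq_iff by (rule state_path_imp_asymptotic[OF path])
    then have "append_letter a x \<in> critical" "append_letter b y \<in> critical"
      unfolding critical_set_iff[OF self_similar] using False
      by (metis append_letter_simps(1))+
    then show ?thesis
      using shift_critical_post_critical by fastforce
  next
    case True
    have "restriction (s 0) [a] v \<noteq> v"
      using Cons.prems(2) is_tree_aut_Cons[OF s0, of a v] b True by auto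
    then have "append_letter a x \<in> post_critical \<and> append_letter b y \<in> post_critical"
      using Cons.IH[OF path] by simp
    then show ?thesis
      using shift_post_critical by fastforce
  qed
qed

text \<open>On the path belonging to a critical word, the state \<open>s 1\<close> moves the last letter. Cutting off the
  last \<open>n + 1\<close> arrows therefore leaves a path that ends at a non-trivial state.\<close>

lemma post_critical_imp_state_path:
  assumes "x \<in> post_critical"
  obtains y s where "state_path N x y s" "s 0 \<noteq> id"
proof -
  obtain n z where z: "z \<in> critical" "x = (\<lambda>k. z (k + Suc n))"
    using assms unfolding post_critical_set_iff by blast
  obtain u where u: "u 0 \<noteq> z 0" "(z, u) \<in> asymptotic_rel G"
    using z(1) unfolding critical_set_iff[OF self_similar] limit_map_eq_iff by blast
  obtain s where s: "state_path N z u s"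
    using asymptotic_imp_state_path[OF u(2)] .
  have "s 1 [z 0] = [u 0]"
    using state_pathD(2)[OF s, of 0] by simp
  then have "s 1 \<noteq> id"
    using u(1) by (metis eq_id_iff list.inject)
  then have "s (0 + Suc n) \<noteq> id"
    using state_path_nontrivial_earlier[OF s, of 1 n] by simp
  moreover have "state_path N x (\<lambda>k. u (k + Suc n)) (\<lambda>k. s (k + Suc n))"
    unfolding z(2) by (rule state_pathI) (simp_all add: state_pathD[OF s])
  ultimately show ?thesis
    using that by blast
qed

text \<open>Each of the two sets is controlled by the other: post-critical words are labels of the counted
  paths, and the labels of a counted path form a pair of post-critical words that is shared by
  finitely many paths.\<close>

lemma finite_post_critical_iff:
  "finite post_critical \<longleftrightarrow>
    finite {e. left_infinite_path (moore_diagram N) e \<and> head (moore_diagram N) (e 0) \<noteq> id}"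
  (is "_ \<longleftrightarrow> finite ?E")
proof -
  have E: "e \<in> ?E \<longleftrightarrow> (\<exists>x y s. state_path N x y s \<and> s 0 \<noteq> id \<and> e = arrow_path x y s)" for e
  proof -
    have "left_infinite_path (moore_diagram N) e \<longleftrightarrow>
        (\<exists>x y s. state_path N x y s \<and> e = arrow_path x y s)"
      by (rule left_infinite_path_iff_state_path) (rule nucleus_restriction)
    moreover have "head (moore_diagram N) (arrow_path x y s 0) = s 0" for x y s
      by (simp add: arrow_path_def moore_diagram_def)
    ultimately show ?thesis
      unfolding mem_Collect_eq by metis
  qed
  show ?thesis
  proof
    assume fin: "finite post_critical"
    have "{s. state_path N x y s} \<subseteq> {s. \<forall>n. s n \<in> N \<and> s n = restriction (s (Suc n)) [x n]}" for x y
      unfolding state_path_def by blast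
    then have "finite {s. state_path N x y s}" for x y
      by (rule finite_subset) (rule finite_coherent_sequences[OF finite_nucleus])
    then have "finite (\<Union>x\<in>post_critical. \<Union>y\<in>post_critical. arrow_path x y ` {s. state_path N x y s})"
      using fin by blast
    moreover have "?E \<subseteq> (\<Union>x\<in>post_critical. \<Union>y\<in>post_critical. arrow_path x y ` {s. state_path N x y s})"
    proof
      fix e assume "e \<in> ?E"
      then obtain x y s where e: "state_path N x y s" "s 0 \<noteq> id" "e = arrow_path x y s"
        unfolding E by blast
      then obtain v where "s 0 v \<noteq> v"
        by (metis eq_id_iff)
      then have "x \<in> post_critical" "y \<in> post_critical"
        using state_path_imp_post_critical[OF e(1)] by auto
      then show "e \<in> (\<Union>x\<in>post_critical. \<Union>y\<in>post_critical. arrow_path x y ` {s. state_path N x y s})"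
        using e by blast
    qed
    ultimately show "finite ?E"
      by (rule finite_subset[rotated])
  next
    assume fin: "finite ?E"
    have "post_critical \<subseteq> (\<lambda>e n. fst (fst (snd (e n)))) ` ?E"
    proof
      fix x assume "x \<in> post_critical"
      then obtain y s where "state_path N x y s" "s 0 \<noteq> id"
        by (rule post_critical_imp_state_path)
      then have "arrow_path x y s \<in> ?E"
        unfolding E by blast
      then show "x \<in> (\<lambda>e n. fst (fst (snd (e n)))) ` ?E"
        by (rule image_eqI[rotated]) (simp add: arrow_path_def)
    qed
    then show "finite post_critical"
      using fin finite_surj by blast
  qed
qed

end

end


section \<open>Post-critical finiteness\<close>

theorem theorem4p7:
  fixes G :: "('x::finite list \<Rightarrow> 'x list) set"
    and F :: "'x \<Rightarrow> 'x left_word set \<Rightarrow> 'x left_word set"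
  assumes "contracting_action G"
    and "self_similar_structure (limit_space G) F (limit_map G)"
  shows "pcf_structure (limit_space G) F (limit_map G) \<longleftrightarrow> pcf_action G"
proof -
  interpret contracting G
    using assms(1) by unfold_locales
  show ?thesis
    unfolding pcf_structure_def pcf_action_def
    using assms finite_post_critical_iff[OF assms(2)] by simp
qed

end
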